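(* Let $P$, $X$, $Y$ be metric spaces, let $C\subset Y$ be a nonempty closed proper subset, and let $F:P\times X\rightrightarrows Y$ be a set-valued mapping with nonempty closed values at every point of $P\times X$. Let $S(p)=\{x\in X: F(p,x)\subseteq C\}$ for $p\in P$ and $\varphi_F(p,x)=\sup_{y\in F(p,x)}\mathrm{dist}(y,C)$. Let $\bar p\in P$ and $\bar x\in S(\bar p)$. Suppose that: (i) $(X,d)$ is metrically complete; (ii) the mapping $F(\cdot,\bar x):P\rightrightarrows Y$ is Lipschitz upper semicontinuous at $\bar p$; (iii) there exists $\delta>0$ such that, for every $p\in B(\bar p,\delta)$, the mapping $F(p,\cdot):X\rightrightarrows Y$ is lower semicontinuous on $X$; (iv) $\overline{|\nabla_x\varphi_F|}{}^{>}(\bar p,\bar x)>0$. Then the solution mapping $S:P\rightrightarrows X$ is Lipschitz lower semicontinuous at $(\bar p,\bar x)$ and $$\mathrm{Liplsc}\,S(\bar p,\bar x)\le\frac{\mathrm{Lipusc}\,F(\cdot,\bar x)(\bar p)}{\overline{|\nabla_x\varphi_F|}{}^{>}(\bar p,\bar x)}.$$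
   Context: All metrics are denoted $d$. $B(x,r)$ is the closed ball of center $x$ and radius $r$; $\mathrm{dist}(x,A)=\inf_{a\in A}d(x,a)$ ($=+\infty$ if $A=\varnothing$); $B(A,r)=\{x:\mathrm{dist}(x,A)\le r\}$. A set-valued mapping $\Phi:X\rightrightarrows Y$ between metric spaces is: - lower semicontinuous (l.s.c.) at $\bar x$ if for every open $O\subseteq Y$ with $\Phi(\bar x)\cap O\neq\varnothing$ there is a neighbourhood $U$ of $\bar x$ with $\Phi(x)\cap O\ne\varnothing$ for all $x\in U$; - Lipschitz lower semicontinuous at $(\bar x,\bar y)$, where $\bar y\in\Phi(\bar x)$, if there are $\delta,\ell>0$ such that $\Phi(x)\cap B(\bar y,\ell d(x,\bar x))\ne\varnothing$ for all $x\in B(\bar x,\delta)$; $\mathrm{Liplsc}\,\Phi(\bar x,\bar y)$ is the infimum of all $\ell>0$ for which such a $\delta>0$ exists; - Lipschitz upper semicontinuous at $\bar x$ if there are $\delta,\ell>0$ such that $\Phi(x)\subseteq B(\Phi(\bar x),\ell d(x,\bar x))$ for all $x\in B(\bar x,\delta)$; $\mathrm{Lipusc}\,\Phi(\bar x)$ is the infimum of all $\ell>0$ for which such a $\delta>0$ exists. The strong slope of $\psi:X\to\mathbb R\cup\{\pm\infty\}$ at a point $x$ with $\psi(x)\in\mathbb R$ is $|\nabla\psi|(x)=0$ if $x$ is a local minimizer of $\psi$, and $|\nabla\psi|(x)=\limsup_{z\to x}\frac{\psi(x)-\psi(z)}{d(z,x)}$ otherwise. The partial strict outer slope of $\varphi_F$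 is $$\overline{|\nabla_x\varphi_F|}{}^{>}(\bar p,\bar x)=\lim_{\epsilon\to0^+}\inf\{|\nabla\varphi_F(p,\cdot)|(x):(p,x)\in B(\bar p,\epsilon)\times B(\bar x,\epsilon),\ \varphi_F(\bar p,\bar x)<\varphi_F(p,x)<\varphi_F(\bar p,\bar x)+\epsilon\},$$ with $\inf\varnothing=+\infty$; a finite number divided by $+\infty$ is $0$. *)

theory Defs
  imports "HOL-Analysis.Analysis"
begin

text \<open>
  Metric spaces are types of class \<^class>\<open>metric_space\<close>, and a set-valued mapping from
  \<open>'a\<close> to \<open>'b\<close> is a function \<open>'a \<Rightarrow> 'b set\<close>.  Quantities that may be infinite (distances to sets,
  moduli, slopes) are of type \<^typ>\<open>ereal\<close>, where the infimum of the empty set is \<open>\<infinity>\<close> and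
  \<open>a / \<infinity> = 0\<close>.
\<close>

definition set_dist :: "'a::metric_space \<Rightarrow> 'a set \<Rightarrow> ereal" where
  "set_dist x A = (INF a\<in>A. ereal (dist x a))"

definition set_cball :: "'a::metric_space set \<Rightarrow> real \<Rightarrow> 'a set" where
  "set_cball A r = {x. set_dist x A \<le> ereal r}"

definition lsc_at :: "('a::metric_space \<Rightarrow> 'b::metric_space set) \<Rightarrow> 'a \<Rightarrow> bool" where
  "lsc_at \<Phi> x0 \<longleftrightarrow>
     (\<forall>V. open V \<and> \<Phi> x0 \<inter> V \<noteq> {} \<longrightarrow> (\<forall>\<^sub>F x in nhds x0. \<Phi> x \<inter> V \<noteq> {}))"

text \<open>
  The case \<open>x = x0\<close> of the following condition forces \<open>y0 \<in> \<Phi> x0\<close>.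
\<close>

definition lip_lsc_const ::
    "('a::metric_space \<Rightarrow> 'b::metric_space set) \<Rightarrow> 'a \<Rightarrow> 'b \<Rightarrow> real \<Rightarrow> bool" where
  "lip_lsc_const \<Phi> x0 y0 l \<longleftrightarrow>
     (\<exists>\<delta>>0. \<forall>x\<in>cball x0 \<delta>. \<Phi> x \<inter> cball y0 (l * dist x x0) \<noteq> {})"

definition lip_lsc_at ::
    "('a::metric_space \<Rightarrow> 'b::metric_space set) \<Rightarrow> 'a \<Rightarrow> 'b \<Rightarrow> bool" where
  "lip_lsc_at \<Phi> x0 y0 \<longleftrightarrow> (\<exists>l>0. lip_lsc_const \<Phi> x0 y0 l)"

definition Liplsc ::
    "('a::metric_space \<Rightarrow> 'b::metric_space set) \<Rightarrow> 'a \<Rightarrow> 'b \<Rightarrow> ereal" where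
  "Liplsc \<Phi> x0 y0 = Inf {ereal l | l. l > 0 \<and> lip_lsc_const \<Phi> x0 y0 l}"

definition lip_usc_const ::
    "('a::metric_space \<Rightarrow> 'b::metric_space set) \<Rightarrow> 'a \<Rightarrow> real \<Rightarrow> bool" where
  "lip_usc_const \<Phi> x0 l \<longleftrightarrow>
     (\<exists>\<delta>>0. \<forall>x\<in>cball x0 \<delta>. \<Phi> x \<subseteq> set_cball (\<Phi> x0) (l * dist x x0))"

definition lip_usc_at :: "('a::metric_space \<Rightarrow> 'b::metric_space set) \<Rightarrow> 'a \<Rightarrow> bool" where
  "lip_usc_at \<Phi> x0 \<longleftrightarrow> (\<exists>l>0. lip_usc_const \<Phi> x0 l)"

definition Lipusc :: "('a::metric_space \<Rightarrow> 'b::metric_space set) \<Rightarrow> 'a \<Rightarrow> ereal" where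
  "Lipusc \<Phi> x0 = Inf {ereal l | l. l > 0 \<and> lip_usc_const \<Phi> x0 l}"

text \<open>
  The strong slope is meaningful only at points \<open>x\<close> where \<open>\<psi> x\<close> is finite.  A point that is not
  a local minimizer is not isolated, so the filter \<open>at x\<close> in the second case is nontrivial.
\<close>

definition strong_slope :: "('a::metric_space \<Rightarrow> ereal) \<Rightarrow> 'a \<Rightarrow> ereal" where
  "strong_slope \<psi> x =
     (if \<forall>\<^sub>F z in nhds x. \<psi> x \<le> \<psi> z then 0
      else Limsup (at x) (\<lambda>z. (\<psi> x - \<psi> z) / ereal (dist z x)))"

definition strict_outer_slope_inf ::
    "('p::metric_space \<Rightarrow> 'x::metric_space \<Rightarrow> ereal) \<Rightarrow> 'p \<Rightarrow> 'x \<Rightarrow> real \<Rightarrow> ereal" where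
  "strict_outer_slope_inf \<phi> p0 x0 \<epsilon> =
     Inf {strong_slope (\<phi> p) x | p x.
            p \<in> cball p0 \<epsilon> \<and> x \<in> cball x0 \<epsilon> \<and>
            \<phi> p0 x0 < \<phi> p x \<and> \<phi> p x < \<phi> p0 x0 + ereal \<epsilon>}"

definition partial_strict_outer_slope ::
    "('p::metric_space \<Rightarrow> 'x::metric_space \<Rightarrow> ereal) \<Rightarrow> 'p \<Rightarrow> 'x \<Rightarrow> ereal" where
  "partial_strict_outer_slope \<phi> p0 x0 = Lim (at_right 0) (strict_outer_slope_inf \<phi> p0 x0)"

text \<open>
  The limit always exists, by monotonicity in \<open>\<epsilon>\<close>.
\<close>

lemma strict_outer_slope_inf_antimono:
  assumes "\<epsilon> \<le> \<epsilon>'"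
  shows "strict_outer_slope_inf \<phi> p0 x0 \<epsilon>' \<le> strict_outer_slope_inf \<phi> p0 x0 \<epsilon>"
proof -
  have "\<phi> p0 x0 + ereal \<epsilon> \<le> \<phi> p0 x0 + ereal \<epsilon>'"
    using assms by (intro add_left_mono) simp
  then show ?thesis
    unfolding strict_outer_slope_inf_def
    using assms by (intro Inf_superset_mono) (force intro: order_trans less_le_trans)
qed

lemma partial_strict_outer_slope_tendsto:
  "(strict_outer_slope_inf \<phi> p0 x0 \<longlongrightarrow> partial_strict_outer_slope \<phi> p0 x0) (at_right 0)"
  and partial_strict_outer_slope_eq_SUP:
  "partial_strict_outer_slope \<phi> p0 x0 = (SUP \<epsilon>\<in>{0<..}. strict_outer_slope_inf \<phi> p0 x0 \<epsilon>)"
proof -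
  let ?f = "strict_outer_slope_inf \<phi> p0 x0"
  have lim: "(?f \<longlongrightarrow> (SUP \<epsilon>\<in>{0<..}. ?f \<epsilon>)) (at_right 0)"
  proof (rule order_tendstoI)
    fix a assume "a < (SUP \<epsilon>\<in>{0<..}. ?f \<epsilon>)"
    then obtain e where e: "e > 0" "a < ?f e"
      by (auto simp: less_SUP_iff)
    have "\<forall>\<^sub>F \<epsilon> in at_right 0. \<epsilon> < e"
      using e(1) by (rule eventually_at_right_real[THEN eventually_mono]) simp
    then show "\<forall>\<^sub>F \<epsilon> in at_right 0. a < ?f \<epsilon>"
      by eventually_elim
        (use e(2) strict_outer_slope_inf_antimono in \<open>meson less_imp_le less_le_trans\<close>)
  next
    fix a assume a: "(SUP \<epsilon>\<in>{0<..}. ?f \<epsilon>) < a"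
    show "\<forall>\<^sub>F \<epsilon> in at_right 0. ?f \<epsilon> < a"
      using eventually_at_right_less[of 0]
      by eventually_elim (use a in \<open>auto intro: le_less_trans[OF SUP_upper]\<close>)
  qed
  then show eq: "partial_strict_outer_slope \<phi> p0 x0 = (SUP \<epsilon>\<in>{0<..}. ?f \<epsilon>)"
    unfolding partial_strict_outer_slope_def by (intro tendsto_Lim) auto
  show "(?f \<longlongrightarrow> partial_strict_outer_slope \<phi> p0 x0) (at_right 0)"
    using lim by (simp add: eq)
qed

definition solution_map :: "('p \<Rightarrow> 'x \<Rightarrow> 'y set) \<Rightarrow> 'y set \<Rightarrow> 'p \<Rightarrow> 'x set" where
  "solution_map F C p = {x. F p x \<subseteq> C}"

definition excess_fun ::
    "('p \<Rightarrow> 'x \<Rightarrow> 'y::metric_space set) \<Rightarrow> 'y set \<Rightarrow> 'p \<Rightarrow> 'x \<Rightarrow> ereal" where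
  "excess_fun F C p x = (SUP y\<in>F p x. set_dist y C)"

end

theory Submission
  imports Defs
begin

text \<open>
  For \<open>p\<close> near \<open>p0\<close>, Lipschitz upper semicontinuity with constant \<open>l\<close> bounds the excess at
  \<open>(p, x0)\<close> by \<open>l * dist p p0\<close>.  Ekeland's variational principle, applied to the lower
  semicontinuous excess at \<open>p\<close> with weight \<open>c\<close> below the outer slope, moves \<open>x0\<close> by at most
  \<open>(l / c) * dist p p0\<close> to a point where the slope is at most \<open>c\<close>.  By the choice of \<open>c\<close> the
  excess cannot be positive there, so this point solves the inclusion.
\<close>

section \<open>Ekeland's variational principle\<close>

text \<open>Lower semicontinuity enters as closedness of sublevel sets. A descending sequence of
  near-minimizers is Cauchy because its values converge, and its limit is minimal for the order
  given by \<open>T\<close>.\<close>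

lemma ekeland_variational_principle:
  fixes f :: "'a::metric_space \<Rightarrow> real"
  assumes complete: "complete (UNIV :: 'a set)"
    and closed_sublevel: "\<And>a. closed {x. f x \<le> a}"
    and bdd: "\<And>x. b \<le> f x"
    and c: "c > 0"
  obtains x where "f x + c * dist x x0 \<le> f x0" "\<And>z. z \<noteq> x \<Longrightarrow> f x < f z + c * dist z x"
proof -
  \<comment> \<open>\<open>T x\<close> is the set of points below \<open>x\<close> in Ekeland's
    order. The second conclusion says exactly that \<open>T x\<close> contains nothing but
    \<open>x\<close>.\<close>
  define T where "T x = {z. f z + c * dist z x \<le> f x}" for x
  have T_refl: "x \<in> T x" for x
    by (simp add: T_def)
  have T_trans: "z \<in> T x" if "z \<in> T y" "y \<in> T x" for x y z
  proof -
    have "c * dist z x \<le> c * dist z y + c * dist y x"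
      using c dist_triangle[of z x y] by (simp flip: distrib_left)
    then show ?thesis
      using that by (simp add: T_def)
  qed
  have step: "\<exists>y. y \<in> T x \<and> (\<forall>z\<in>T x. f y \<le> f z + 1 / Suc n)" for x n
  proof -
    have bdd_T: "bdd_below (f ` T x)"
      using bdd by (intro bdd_belowI[of _ b]) auto
    have "Inf (f ` T x) < Inf (f ` T x) + 1 / Suc n"
      by simp
    then obtain y where "y \<in> T x" "f y < Inf (f ` T x) + 1 / Suc n"
      using T_refl[of x] bdd_T by (subst (asm) cInf_less_iff) auto
    moreover have "Inf (f ` T x) \<le> f z" if "z \<in> T x" for z
      using that bdd_T by (auto intro: cInf_lower)
    ultimately show ?thesis
      by (intro exI[of _ y]) force
  qed
  have "\<exists>u. \<forall>n. (n = 0 \<longrightarrow> u n = x0) \<and>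
      (u (Suc n) \<in> T (u n) \<and> (\<forall>z\<in>T (u n). f (u (Suc n)) \<le> f z + 1 / Suc n))"
    by (rule dependent_nat_choice) (use step in auto)
  then obtain u where u0: "u 0 = x0" and u_T: "\<And>n. u (Suc n) \<in> T (u n)"
    and u_min: "\<And>n z. z \<in> T (u n) \<Longrightarrow> f (u (Suc n)) \<le> f z + 1 / Suc n"
    by auto
  have u_mono: "u m \<in> T (u n)" if "n \<le> m" for m n
    using that by (induction rule: dec_induct) (use T_refl T_trans u_T in blast)+
  have "f (u m) \<le> f (u n)" if "n \<le> m" for m n
    using u_mono[OF that] c zero_le_dist[of "u m" "u n"]
    by (auto simp: T_def intro: order_trans[rotated])
  then have "decseq (\<lambda>n. f (u n))"
    by (auto simp: decseq_def)
  then have "Cauchy (\<lambda>n. f (u n))"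
    using decseq_convergent[of "\<lambda>n. f (u n)" b] bdd convergentI LIMSEQ_imp_Cauchy by metis
  \<comment> \<open>For \<open>n\<close> beyond \<open>N\<close>, \<open>u n\<close> lies in
    \<open>T (u N)\<close>, so \<open>c * dist (u n) (u N)\<close> is at most the drop in
    \<open>f\<close>.\<close>
  have "Cauchy u"
    unfolding Cauchy_altdef2
  proof (intro allI impI)
    fix e :: real assume "e > 0"
    then obtain N where N: "\<And>n. n \<ge> N \<Longrightarrow> dist (f (u n)) (f (u N)) < c * e"
      using \<open>Cauchy (\<lambda>n. f (u n))\<close> c unfolding Cauchy_altdef2 by (metis mult_pos_pos)
    have "dist (u n) (u N) < e" if "n \<ge> N" for n
    proof -
      have "c * dist (u n) (u N) < c * e"
        using u_mono[OF that] N[OF that] by (auto simp: T_def dist_real_def)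
      then show ?thesis
        using c by simp
    qed
    then show "\<exists>N. \<forall>n\<ge>N. dist (u n) (u N) < e"
      by blast
  qed
  then obtain x where lim: "u \<longlonglongrightarrow> x"
    using complete unfolding complete_def by blast
  have x_T: "x \<in> T (u n)" for n
  proof -
    \<comment> \<open>The bound on \<open>f (u m)\<close> moves with \<open>m\<close>. The slack
      \<open>e\<close> replaces it by a fixed level, so that a single closed sublevel set contains
      the tail of \<open>u\<close>.\<close>
    have "f x \<le> (f (u n) - c * dist x (u n)) + e" if "e > 0" for e
    proof -
      have "(\<lambda>m. f (u n) - c * dist (u m) (u n)) \<longlonglongrightarrow> f (u n) - c * dist x (u n)"
        by (intro tendsto_intros lim)
      then have "\<forall>\<^sub>F m in sequentially. f (u n) - c * dist (u m) (u n)
          < (f (u n) - c * dist x (u n)) + e"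
        by (rule order_tendstoD) (use that in simp)
      then have "\<forall>\<^sub>F m in sequentially. u m \<in> {y. f y \<le> (f (u n) - c * dist x (u n)) + e}"
        using eventually_ge_at_top[of n]
      proof eventually_elim
        case (elim m)
        then show ?case
          using u_mono[of n m] by (simp add: T_def)
      qed
      then have "x \<in> {y. f y \<le> (f (u n) - c * dist x (u n)) + e}"
        using Lim_in_closed_set[OF closed_sublevel _ _ lim] by simp
      then show ?thesis
        by simp
    qed
    then have "f x \<le> f (u n) - c * dist x (u n)"
      by (rule field_le_epsilon)
    then show ?thesis
      by (simp add: T_def)
  qed
  show thesis
  proof (rule that)
    show "f x + c * dist x x0 \<le> f x0"
      using x_T[of 0] u0 by (simp add: T_def)
    fix z assume "z \<noteq> x"
    show "f x < f z + c * dist z x"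
    proof (rule ccontr)
      assume "\<not> ?thesis"
      \<comment> \<open>A violating \<open>z\<close> lies below \<open>x\<close>, hence below every
        \<open>u n\<close>. Near-minimality of \<open>u (Suc n)\<close> then gives
        \<open>f x \<le> f z\<close>, and membership in \<open>T x\<close> forces
        \<open>z = x\<close>.\<close>
      then have z: "z \<in> T x"
        by (simp add: T_def)
      have "f x \<le> f z + 1 / Suc n" for n
      proof -
        have "f x \<le> f (u (Suc n))"
          using x_T[of "Suc n"] c zero_le_dist[of x "u (Suc n)"]
          by (auto simp: T_def intro: order_trans[rotated])
        also have "\<dots> \<le> f z + 1 / Suc n"
          using u_min T_trans[OF z x_T] by blast
        finally show ?thesis .
      qed
      moreover have "(\<lambda>n. f z + 1 / Suc n) \<longlonglongrightarrow> f z + 0"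
        by (intro tendsto_intros LIMSEQ_inverse_real_of_nat[unfolded inverse_eq_divide])
      ultimately have "f x \<le> f z"
        by (auto intro: LIMSEQ_le_const)
      then have "c * dist z x \<le> 0"
        using z by (simp add: T_def)
      then show False
        using c \<open>z \<noteq> x\<close> by (simp add: mult_le_0_iff)
    qed
  qed
qed

lemma ekeland_variational_principle_ereal:
  fixes f :: "'a::metric_space \<Rightarrow> ereal"
  assumes complete: "complete (UNIV :: 'a set)"
    and closed_sublevel: "\<And>a. closed {x. f x \<le> a}"
    and nonneg: "\<And>x. 0 \<le> f x"
    and c: "c > 0"
    and fin: "f x0 \<noteq> \<infinity>"
  obtains x where "f x + ereal (c * dist x x0) \<le> f x0"
    "\<And>z. z \<noteq> x \<Longrightarrow> f x < f z + ereal (c * dist z x)"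
proof -
  \<comment> \<open>Truncating at \<open>f x0\<close> makes the function real-valued without changing it at the point found.\<close>
  define g where "g x = real_of_ereal (min (f x) (f x0))" for x
  have ereal_g: "ereal (g x) = min (f x) (f x0)" for x
    using nonneg[of x] nonneg[of x0] fin unfolding g_def
    by (cases "f x"; cases "f x0") (auto simp: min_def)
  \<comment> \<open>Truncation preserves closed sublevel sets: each one is the whole space or a
    sublevel set of \<open>f\<close>.\<close>
  have "{x. g x \<le> a} = (if f x0 \<le> ereal a then UNIV else {x. f x \<le> ereal a})" for a
    by (auto simp flip: ereal_less_eq(3) simp: ereal_g min_le_iff_disj)
  then have "closed {x. g x \<le> a}" for a
    using closed_sublevel by simp
  moreover have "0 \<le> g x" for x
    using nonneg by (simp add: g_def real_of_ereal_pos)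
  ultimately obtain x where x: "g x + c * dist x x0 \<le> g x0"
    "\<And>z. z \<noteq> x \<Longrightarrow> g x < g z + c * dist z x"
    using ekeland_variational_principle[OF complete, of g 0 c x0] c by metis
  \<comment> \<open>Away from \<open>x0\<close> the value \<open>g x\<close> is strictly below
    \<open>g x0\<close>, so the truncation is inactive at \<open>x\<close>.\<close>
  have "f x = ereal (g x)"
  proof (cases "x = x0")
    case False
    then have "c * dist x x0 > 0"
      using c by simp
    then have "ereal (g x) < ereal (g x0)"
      using x(1) by simp
    then show ?thesis
      by (auto simp: ereal_g min_def split: if_splits)
  qed (simp add: ereal_g)
  show thesis
  proof (rule that)
    have "ereal (g x) + ereal (c * dist x x0) \<le> ereal (g x0)"
      using x(1) by simp
    then show "f x + ereal (c * dist x x0) \<le> f x0"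
      using \<open>f x = ereal (g x)\<close> ereal_g[of x0] by simp
    fix z assume "z \<noteq> x"
    then have "ereal (g x) < ereal (g z) + ereal (c * dist z x)"
      using x(2) by simp
    also have "\<dots> \<le> f z + ereal (c * dist z x)"
      by (intro add_right_mono) (simp add: ereal_g)
    finally show "f x < f z + ereal (c * dist z x)"
      using \<open>f x = ereal (g x)\<close> by simp
  qed
qed

section \<open>Slopes, distances and the excess function\<close>

text \<open>The hypothesis bounds every difference quotient by \<open>c\<close>; it is the form in
  which Ekeland's principle delivers its point. The sign of \<open>c\<close> covers local
  minimizers, where the slope is 0 by definition.\<close>

lemma strong_slope_le:
  assumes "\<And>z. z \<noteq> x \<Longrightarrow> \<psi> x \<le> \<psi> z + ereal (c * dist z x)"
    and "c \<ge> 0" and "\<bar>\<psi> x\<bar> \<noteq> \<infinity>"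
  shows "strong_slope \<psi> x \<le> ereal c"
proof (cases "\<forall>\<^sub>F z in nhds x. \<psi> x \<le> \<psi> z")
  case False
  have "(\<psi> x - \<psi> z) / ereal (dist z x) \<le> ereal c" if "z \<noteq> x" for z
    using assms(1)[OF that] assms(2,3) that
    by (cases "\<psi> x"; cases "\<psi> z") (auto simp: divide_le_eq)
  then have "\<forall>\<^sub>F z in at x. (\<psi> x - \<psi> z) / ereal (dist z x) \<le> ereal c"
    by (auto simp: eventually_at_filter)
  then have "Limsup (at x) (\<lambda>z. (\<psi> x - \<psi> z) / ereal (dist z x)) \<le> ereal c"
    by (rule Limsup_bounded)
  then show ?thesis
    using False by (simp add: strong_slope_def)
qed (use assms(2) in \<open>simp add: strong_slope_def\<close>)

text \<open>This gives access to the continuity of \<open>infdist\<close>. The two notions differ on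
  the empty set, where \<open>infdist\<close> is 0 and \<open>set_dist\<close> is
  \<open>\<infinity>\<close>.\<close>

lemma set_dist_eq_infdist:
  assumes "A \<noteq> {}"
  shows "set_dist x A = ereal (infdist x A)"
  unfolding set_dist_def infdist_notempty[OF assms]
  using assms by (intro ereal_Inf'[of "dist x ` A", unfolded image_image, symmetric]) auto

lemma set_dist_antimono:
  "A \<subseteq> B \<Longrightarrow> set_dist x B \<le> set_dist x A"
  by (simp add: set_dist_def INF_superset_mono)

lemma set_dist_nonneg: "0 \<le> set_dist x A"
  by (auto simp: set_dist_def intro: INF_greatest)

lemma excess_fun_nonneg:
  assumes "F p x \<noteq> {}"
  shows "0 \<le> excess_fun F C p x"
  using assms set_dist_nonneg by (auto simp: excess_fun_def intro: SUP_upper2)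

text \<open>Closedness of \<open>C\<close> turns distance 0 into membership. Nonempty values keep
  the supremum from being \<open>-\<infinity>\<close>.\<close>

lemma excess_fun_eq_0_iff:
  assumes "closed C" "C \<noteq> {}" "F p x \<noteq> {}"
  shows "excess_fun F C p x = 0 \<longleftrightarrow> x \<in> solution_map F C p"
proof -
  have "excess_fun F C p x = 0 \<longleftrightarrow> excess_fun F C p x \<le> 0"
    using excess_fun_nonneg[of F p x C, OF assms(3)] by (auto intro: antisym)
  also have "\<dots> \<longleftrightarrow> (\<forall>y\<in>F p x. infdist y C \<le> 0)"
    by (simp add: excess_fun_def SUP_le_iff set_dist_eq_infdist[OF assms(2)])
  also have "\<dots> \<longleftrightarrow> (\<forall>y\<in>F p x. infdist y C = 0)"
    by (simp add: infdist_nonneg antisym_conv)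
  also have "\<dots> \<longleftrightarrow> x \<in> solution_map F C p"
    using in_closed_iff_infdist_zero[OF assms(1,2)] by (auto simp: solution_map_def)
  finally show ?thesis .
qed

text \<open>The excess exceeds \<open>a\<close> exactly where \<open>F p x\<close> meets the open
  set \<open>V\<close> of points farther than \<open>a\<close> from \<open>C\<close>. By lower
  semicontinuity this is an open condition on \<open>x\<close>.\<close>

lemma closed_sublevel_excess_fun:
  assumes "C \<noteq> {}" and "\<And>x. lsc_at (F p) x"
  shows "closed {x. excess_fun F C p x \<le> a}"
proof -
  define V where "V = {y. a < set_dist y C}"
  have "open V"
    unfolding V_def set_dist_eq_infdist[OF assms(1)]
    by (intro open_Collect_less continuous_intros)
  have "open {x. F p x \<inter> V \<noteq> {}}"
    unfolding open_subopen[of "{x. F p x \<inter> V \<noteq> {}}"]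
  proof
    fix x assume "x \<in> {x. F p x \<inter> V \<noteq> {}}"
    then have "\<forall>\<^sub>F z in nhds x. F p z \<inter> V \<noteq> {}"
      using assms(2) \<open>open V\<close> by (simp add: lsc_at_def)
    then show "\<exists>T. open T \<and> x \<in> T \<and> T \<subseteq> {x. F p x \<inter> V \<noteq> {}}"
      unfolding eventually_nhds by blast
  qed
  moreover have "- {x. excess_fun F C p x \<le> a} = {x. F p x \<inter> V \<noteq> {}}"
    by (auto simp: excess_fun_def V_def SUP_le_iff not_le)
  ultimately show ?thesis
    by (simp add: closed_def)
qed

section \<open>Lipschitz lower semicontinuity of the solution map\<close>

lemma lip_lsc_const_solution_map:
  fixes F :: "'p::metric_space \<Rightarrow> 'x::metric_space \<Rightarrow> 'y::metric_space set"
  assumes C: "C \<noteq> {}" "closed C"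
    and F: "\<And>p x. F p x \<noteq> {}"
    and x0: "x0 \<in> solution_map F C p0"
    and complete: "complete (UNIV :: 'x set)"
    and usc: "lip_usc_const (\<lambda>p. F p x0) p0 l" and l: "l > 0"
    and lsc: "\<exists>\<delta>>0. \<forall>p\<in>cball p0 \<delta>. \<forall>x. lsc_at (F p) x"
    and c: "0 < c" "ereal c < partial_strict_outer_slope (excess_fun F C) p0 x0"
  shows "lip_lsc_const (solution_map F C) p0 x0 (l / c)"
proof -
  let ?\<phi> = "excess_fun F C"
  have \<phi>0: "?\<phi> p0 x0 = 0"
    using C F x0 by (simp add: excess_fun_eq_0_iff)
  obtain \<epsilon> where \<epsilon>: "\<epsilon> > 0" "ereal c < strict_outer_slope_inf ?\<phi> p0 x0 \<epsilon>"
    using c(2) by (auto simp: partial_strict_outer_slope_eq_SUP less_SUP_iff)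
  obtain \<delta>1 where \<delta>1: "\<delta>1 > 0"
    "\<And>p. p \<in> cball p0 \<delta>1 \<Longrightarrow> F p x0 \<subseteq> set_cball (F p0 x0) (l * dist p p0)"
    using usc by (auto simp: lip_usc_const_def)
  obtain \<delta>2 where \<delta>2: "\<delta>2 > 0" "\<And>p x. p \<in> cball p0 \<delta>2 \<Longrightarrow> lsc_at (F p) x"
    using lsc by blast
  \<comment> \<open>The first two terms make both semicontinuity hypotheses available. The others
    place the point found in the region defining the outer slope: \<open>\<epsilon>\<close> for
    \<open>p\<close>, \<open>\<epsilon> * c / l\<close> for its distance to \<open>x0\<close>, and
    \<open>\<epsilon> / (2 * l)\<close> for an excess of at most \<open>\<epsilon> / 2\<close>,
    hence strictly below \<open>\<epsilon>\<close>.\<close>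
  define \<delta> where "\<delta> = Min {\<delta>1, \<delta>2, \<epsilon>, \<epsilon> * c / l, \<epsilon> / (2 * l)}"
  have "\<delta> > 0"
    using \<delta>1 \<delta>2 \<epsilon> c l by (simp add: \<delta>_def)
  moreover have "solution_map F C p \<inter> cball x0 (l / c * dist p p0) \<noteq> {}" if "p \<in> cball p0 \<delta>" for p
  proof -
    have p: "dist p p0 \<le> \<delta>1" "dist p p0 \<le> \<delta>2" "dist p p0 \<le> \<epsilon>"
      "dist p p0 \<le> \<epsilon> * c / l" "dist p p0 \<le> \<epsilon> / (2 * l)"
      using that by (auto simp: \<delta>_def dist_commute)
    have \<phi>_le: "?\<phi> p x0 \<le> ereal (l * dist p p0)"
      unfolding excess_fun_def
    proof (rule SUP_least)
      fix y assume "y \<in> F p x0"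
      then have "set_dist y (F p0 x0) \<le> ereal (l * dist p p0)"
        using \<delta>1(2)[of p] p by (auto simp: set_cball_def dist_commute)
      moreover have "set_dist y C \<le> set_dist y (F p0 x0)"
        using x0 by (intro set_dist_antimono) (simp add: solution_map_def)
      ultimately show "set_dist y C \<le> ereal (l * dist p p0)"
        by simp
    qed
    have nonneg: "0 \<le> ?\<phi> p x" for x
      using F by (rule excess_fun_nonneg)
    have "closed {x. ?\<phi> p x \<le> a}" for a
      using \<delta>2(2)[of p] p C by (intro closed_sublevel_excess_fun) (auto simp: dist_commute)
    then obtain x where x: "?\<phi> p x + ereal (c * dist x x0) \<le> ?\<phi> p x0"
      "\<And>z. z \<noteq> x \<Longrightarrow> ?\<phi> p x < ?\<phi> p z + ereal (c * dist z x)"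
      using ekeland_variational_principle_ereal[OF complete, of "?\<phi> p" c x0] nonneg c(1) \<phi>_le
      by (metis ereal_infty_less_eq(1) PInfty_neq_ereal(1))
    have "?\<phi> p x + ereal (c * dist x x0) \<le> ereal (l * dist p p0)"
      using x(1) \<phi>_le by (rule order_trans)
    then obtain r where r: "?\<phi> p x = ereal r" "0 \<le> r" "r + c * dist x x0 \<le> l * dist p p0"
      using nonneg[of x] by (cases "?\<phi> p x") auto
    then have dist_x: "dist x x0 \<le> l / c * dist p p0"
      using c(1) by (simp add: field_simps)
    \<comment> \<open>A positive excess would make the slope at \<open>x\<close> one of the
      competitors in the infimum, which is above \<open>c\<close>, while Ekeland's principle makes
      that slope at most \<open>c\<close>.\<close>
    have "r = 0"
    proof (rule ccontr)
      assume "r \<noteq> 0"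
      have "l / c * dist p p0 \<le> \<epsilon>"
        using p(4) l c(1) by (simp add: field_simps)
      moreover have "r \<le> l * dist p p0"
        using r(3) c(1) zero_le_dist[of x x0] by (meson add_increasing2 le_add_same_cancel1
            mult_nonneg_nonneg less_imp_le order_trans)
      moreover have "l * dist p p0 \<le> \<epsilon> / 2"
        using p(5) l by (simp add: field_simps)
      ultimately have "p \<in> cball p0 \<epsilon> \<and> x \<in> cball x0 \<epsilon> \<and>
          ?\<phi> p0 x0 < ?\<phi> p x \<and> ?\<phi> p x < ?\<phi> p0 x0 + ereal \<epsilon>"
        using p(3) dist_x r \<open>r \<noteq> 0\<close> \<epsilon>(1) \<phi>0 by (simp add: dist_commute)
      then have "strict_outer_slope_inf ?\<phi> p0 x0 \<epsilon> \<le> strong_slope (?\<phi> p) x"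
        unfolding strict_outer_slope_inf_def by (intro Inf_lower) blast
      also have "\<dots> \<le> ereal c"
        using x(2) c(1) r(1) by (intro strong_slope_le) (auto intro: less_imp_le)
      finally show False
        using \<epsilon>(2) by simp
    qed
    then have "x \<in> solution_map F C p"
      using r(1) C F by (simp flip: excess_fun_eq_0_iff add: zero_ereal_def)
    then show ?thesis
      using dist_x by (auto simp: dist_commute)
  qed
  ultimately show ?thesis
    unfolding lip_lsc_const_def by blast
qed

theorem theorem3p1:
  fixes F :: "'p::metric_space \<Rightarrow> 'x::metric_space \<Rightarrow> 'y::metric_space set"
    and C :: "'y set" and p0 :: 'p and x0 :: 'x
  assumes "C \<noteq> {}" and "closed C" and "C \<noteq> UNIV"
    and "\<And>p x. F p x \<noteq> {}" and "\<And>p x. closed (F p x)"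
    and "x0 \<in> solution_map F C p0"
    and "complete (UNIV :: 'x set)"
    and "lip_usc_at (\<lambda>p. F p x0) p0"
    and "\<exists>\<delta>>0. \<forall>p\<in>cball p0 \<delta>. \<forall>x. lsc_at (F p) x"
    and "partial_strict_outer_slope (excess_fun F C) p0 x0 > 0"
  shows "lip_lsc_at (solution_map F C) p0 x0 \<and>
    Liplsc (solution_map F C) p0 x0
      \<le> Lipusc (\<lambda>p. F p x0) p0 / partial_strict_outer_slope (excess_fun F C) p0 x0"
proof -
  let ?L = "Lipusc (\<lambda>p. F p x0) p0"
  let ?M = "Liplsc (solution_map F C) p0 x0"
  let ?\<sigma> = "partial_strict_outer_slope (excess_fun F C) p0 x0"
  have const: "lip_lsc_const (solution_map F C) p0 x0 (l / c)"
    if "l > 0" "lip_usc_const (\<lambda>p. F p x0) p0 l" "0 < c" "ereal c < ?\<sigma>" for l c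
    using lip_lsc_const_solution_map[OF assms(1,2,4,6,7) that(2,1) assms(9) that(3,4)] .
  have "\<exists>l>0. lip_usc_const (\<lambda>p. F p x0) p0 l"
    using assms(8) by (simp add: lip_usc_at_def)
  moreover obtain c where "0 < c" "ereal c < ?\<sigma>"
    using ereal_dense2[OF assms(10)] by (auto simp: zero_ereal_def)
  ultimately have "lip_lsc_at (solution_map F C) p0 x0"
    using const unfolding lip_lsc_at_def by (metis divide_pos_pos)
  moreover have "?M \<le> ?L / ?\<sigma>"
  proof (rule ccontr)
    assume "\<not> ?thesis"
    \<comment> \<open>A real \<open>m\<close> strictly between the two sides leaves room to choose
      \<open>l\<close> near \<open>?L\<close> and \<open>c\<close> near \<open>?\<sigma>\<close>
      with \<open>l / c < m\<close>.\<close>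
    then obtain m where m: "?L / ?\<sigma> < ereal m" "ereal m < ?M"
      using ereal_dense2[of "?L / ?\<sigma>" ?M] by (auto simp: not_le)
    have "0 \<le> ?L"
      by (auto simp: Lipusc_def intro!: Inf_greatest)
    then have "0 \<le> ?L / ?\<sigma>"
      using assms(10) by (simp add: zero_le_divide_ereal)
    then have "m > 0"
      using m(1) by (metis ereal_less(2) le_less_trans)
    \<comment> \<open>Finiteness settles the case \<open>?\<sigma> = \<infinity>\<close> below: the
      quotient is then 0 and says nothing about \<open>?L\<close>, but
      \<open>ereal m * ?\<sigma>\<close> is infinite.\<close>
    have "?L < \<infinity>"
    proof -
      obtain l where "l > 0" "lip_usc_const (\<lambda>p. F p x0) p0 l"
        using assms(8) by (auto simp: lip_usc_at_def)
      then have "?L \<le> ereal l"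
        unfolding Lipusc_def by (intro Inf_lower) auto
      then show ?thesis
        using le_less_trans less_ereal.simps(4) by blast
    qed
    then have "?L < ereal m * ?\<sigma>"
      using m(1) assms(10) \<open>m > 0\<close>
      by (cases "?\<sigma> = \<infinity>") (auto simp: ereal_divide_less_iff)
    then obtain l where l: "l > 0" "lip_usc_const (\<lambda>p. F p x0) p0 l" "ereal l < ereal m * ?\<sigma>"
      by (auto simp: Lipusc_def Inf_less_iff)
    have "ereal (l / m) < ?\<sigma>"
      using l(3) \<open>m > 0\<close> assms(10) by (cases ?\<sigma>) (auto simp: field_simps)
    \<comment> \<open>\<open>c > l / m\<close> yields \<open>l / c < m\<close>, and \<open>c\<close>
      below the outer slope makes \<open>l / c\<close> an admissible constant, contradicting
      \<open>m < ?M\<close>.\<close>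
    then obtain c where c: "l / m < c" "ereal c < ?\<sigma>"
      using ereal_dense2 by fastforce
    have "0 < l / m"
      using l(1) \<open>m > 0\<close> by simp
    then have "0 < c"
      using c(1) by linarith
    then have "?M \<le> ereal (l / c)"
      using const[OF l(1,2) _ c(2)] l(1) unfolding Liplsc_def by (intro Inf_lower) auto
    moreover have "l / c < m"
      using c(1) \<open>0 < c\<close> \<open>m > 0\<close> by (simp add: field_simps)
    ultimately show False
      using m(2) by (metis ereal_less_eq(3) less_le_trans not_le order_trans less_imp_le)
  qed
  ultimately show ?thesis ..
qed

end
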